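(* For every real $\lambda$ with $1.8\le\lambda<2$, every (nontrivial) relator of $G_{\lambda,2}$ admits a subword of the form $(A_\lambda B_2^{-1})^k$ or $(A_\lambda^{-1}B_2)^k$, where $k$ is a nonnegative integer with $$k>\frac{1}{4\arccos(\sqrt{\lambda/2})}-1.$$ In particular, $\sigma(G_{\lambda,2})>2\left(\frac{1}{4\arccos(\sqrt{\lambda/2})}-1\right)$.
   Context: For $\lambda,\mu\in\mathbb{C}$ let $A_\lambda=\begin{pmatrix}1&\lambda\\0&1\end{pmatrix}$, $B_\mu=\begin{pmatrix}1&0\\ \mu&1\end{pmatrix}$, and $G_{\lambda,\mu}=\langle A_\lambda,B_\mu\rangle\subseteq\mathrm{SL}_2(\mathbb{C})$, with generating set $S=\{A_\lambda,B_\mu\}$. Words are reduced words in two formal letters corresponding to the generators (elements of the free group on these letters). A relator of $G_{\lambda,\mu}$ is a nonempty reduced word in the generators that equals $1$ in the group. A subword is a contiguous subword. If $w=s_1^{n_1}\cdots s_k^{n_k}$ is the reduced form of a word ($s_j\in S$, $s_j\neq s_{j+1}^{\pm1}$ as letters, $n_j\in\mathbb{Z}\setminus\{0\}$), then $\operatorname{syl}(w)=k$ is its number of syllables. For a group $G$ with generating set $S$, $\sigma(G)=\sigma_S(G)$ is the minimum of $\operatorname{syl}(w)$ over all relators $w$, and $\sigma(G)=\infty$ if $S$ freely generates $G$. *)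

theory Defs
  imports
    "HOL-Analysis.Analysis"
    "HOL-Algebra.Generated_Groups"
    "HOL-Library.Sublist"
begin

section \<open>Words in formal letters\<close>

text \<open>A word is a list of signed letters: \<open>(s, True)\<close> stands for the letter \<open>s\<close> and
  \<open>(s, False)\<close> for its formal inverse. The reduced words represent the elements of the free
  group on \<open>'l\<close>.\<close>

type_synonym 'l word = "('l \<times> bool) list"

definition flip :: "'l \<times> bool \<Rightarrow> 'l \<times> bool" where
  "flip x = (fst x, \<not> snd x)"

definition reduced :: "'l word \<Rightarrow> bool" where
  "reduced w \<longleftrightarrow> successively (\<lambda>x y. y \<noteq> flip x) w"

definition word_power :: "'l word \<Rightarrow> nat \<Rightarrow> 'l word" where
  "word_power w k = concat (replicate k w)"

text \<open>\<open>expand [(s\<^sub>1, n\<^sub>1), \<dots>, (s\<^sub>k, n\<^sub>k)]\<close> is the word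
  \<open>s\<^sub>1\<close> to the power \<open>n\<^sub>1\<close>, \<open>\<dots>\<close>, \<open>s\<^sub>k\<close> to the power \<open>n\<^sub>k\<close>.\<close>

definition expand :: "('l \<times> int) list \<Rightarrow> 'l word" where
  "expand ss = concat (map (\<lambda>(s, n). replicate (nat \<bar>n\<bar>) (s, n > 0)) ss)"

definition syllable_form :: "'l word \<Rightarrow> ('l \<times> int) list \<Rightarrow> bool" where
  "syllable_form w ss \<longleftrightarrow>
     w = expand ss \<and> (\<forall>(s, n) \<in> set ss. n \<noteq> 0) \<and> distinct_adj (map fst ss)"

definition syl :: "'l word \<Rightarrow> nat" where
  "syl w = (THE k. \<exists>ss. syllable_form w ss \<and> length ss = k)"

lemma remdups_adj_replicate_append:
  assumes "m > 0" "ys = [] \<or> hd ys \<noteq> x"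
  shows "remdups_adj (replicate m x @ ys) = x # remdups_adj ys"
  using assms(1)
proof (induction m)
  case (Suc m)
  show ?case
  proof (cases m)
    case 0
    then show ?thesis using assms(2) by (cases ys) auto
  next
    case (Suc m')
    then show ?thesis using Suc.IH by simp
  qed
qed simp

lemma remdups_adj_expand:
  assumes "\<forall>(s, n) \<in> set ss. n \<noteq> 0" "distinct_adj (map fst ss)"
  shows "remdups_adj (map fst (expand ss)) = map fst ss"
  using assms
proof (induction ss)
  case (Cons p ss)
  obtain s n where p: "p = (s, n)" by force
  have IH: "remdups_adj (map fst (expand ss)) = map fst ss"
    using Cons by (auto simp: distinct_adj_Cons)
  have hd: "map fst (expand ss) = [] \<or> hd (map fst (expand ss)) \<noteq> s"
  proof (cases "map fst (expand ss) = []")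
    case False
    then have "hd (map fst (expand ss)) = hd (map fst ss)"
      using IH by (metis hd_remdups_adj)
    moreover have "ss \<noteq> []" using False by (auto simp: expand_def)
    ultimately show ?thesis using Cons.prems(2) p by (cases ss) auto
  qed simp
  have "map fst (expand (p # ss)) = replicate (nat \<bar>n\<bar>) s @ map fst (expand ss)"
    by (simp add: expand_def p)
  moreover have "nat \<bar>n\<bar> > 0" using Cons.prems(1) p by auto
  ultimately show ?case using remdups_adj_replicate_append[OF _ hd] IH p by simp
qed (simp add: expand_def)

lemma syl_eq:
  assumes "syllable_form w ss"
  shows "syl w = length ss"
proof -
  have *: "length ts = length (remdups_adj (map fst w))" if "syllable_form w ts" for ts
    using remdups_adj_expand[of ts] that unfolding syllable_form_def by (metis length_map)
  show ?thesis
    unfolding syl_def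
  proof (rule the_equality)
    show "\<exists>ts. syllable_form w ts \<and> length ts = length ss" using assms by blast
  next
    fix k assume "\<exists>ts. syllable_form w ts \<and> length ts = k"
    then show "k = length ss" using *[OF assms] * by auto
  qed
qed

lemma reduced_syllable_form:
  assumes "reduced w"
  shows "\<exists>ss. syllable_form w ss"
  using assms
proof (induction w)
  case Nil
  then show ?case by (intro exI[of _ "[]"]) (simp add: syllable_form_def expand_def)
next
  case (Cons x w)
  obtain l b where x: "x = (l, b)" by force
  define e :: int where "e = (if b then 1 else -1)"
  from Cons obtain ss where ss: "syllable_form w ss"
    by (auto simp: reduced_def successively_Cons)
  show ?case
  proof (cases ss)
    case Nil
    then have "syllable_form (x # w) [(l, e)]"
      using ss by (auto simp: syllable_form_def expand_def x e_def)
    then show ?thesis by blast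
  next
    case (Cons p ts)
    obtain s n where p: "p = (s, n)" by force
    have n: "n \<noteq> 0" using ss Cons p by (auto simp: syllable_form_def)
    then obtain m where m: "nat \<bar>n\<bar> = Suc m" by (cases "nat \<bar>n\<bar>") auto
    have w: "w = replicate (Suc m) (s, n > 0) @ expand ts"
      using ss Cons p m by (auto simp: syllable_form_def expand_def)
    show ?thesis
    proof (cases "s = l")
      case False
      then have "syllable_form (x # w) ((l, e) # ss)"
        using ss Cons p by (auto simp: syllable_form_def expand_def x e_def)
      then show ?thesis by blast
    next
      case True
      have b: "b = (n > 0)"
        using \<open>reduced (x # w)\<close> w True by (auto simp: reduced_def x flip_def)
      have "nat \<bar>n + e\<bar> = Suc (Suc m)" "(n + e > 0) = b" "n + e \<noteq> 0"
        using m n b by (auto simp: e_def split: if_splits)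
      then have "syllable_form (x # w) ((l, n + e) # ts)"
        using ss Cons p w b True
        by (auto simp: syllable_form_def expand_def x distinct_adj_Cons)
      then show ?thesis by blast
    qed
  qed
qed


section \<open>Relators\<close>

text \<open>The family \<open>g\<close> assigns to each formal letter the generator it stands for.\<close>

definition word_value :: "('a, 'b) monoid_scheme \<Rightarrow> ('l \<Rightarrow> 'a) \<Rightarrow> 'l word \<Rightarrow> 'a" where
  "word_value G g w =
     foldr (\<lambda>(s, b) y. (if b then g s else inv\<^bsub>G\<^esub> (g s)) \<otimes>\<^bsub>G\<^esub> y) w \<one>\<^bsub>G\<^esub>"

definition relator :: "('a, 'b) monoid_scheme \<Rightarrow> ('l \<Rightarrow> 'a) \<Rightarrow> 'l word \<Rightarrow> bool" where
  "relator G g w \<longleftrightarrow> w \<noteq> [] \<and> reduced w \<and> word_value G g w = \<one>\<^bsub>G\<^esub>"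

text \<open>If there is no relator, i.e. if \<open>g\<close> freely generates \<open>G\<close>, the infimum of the empty set
  gives \<open>\<infinity>\<close>; otherwise the infimum is a minimum.\<close>

definition sigma_syl :: "('a, 'b) monoid_scheme \<Rightarrow> ('l \<Rightarrow> 'a) \<Rightarrow> enat" where
  "sigma_syl G g = (INF w \<in> {w. relator G g w}. enat (syl w))"


section \<open>The groups generated by two parabolic matrices\<close>

definition SL2C :: "(complex^2^2) monoid" where
  "SL2C = \<lparr>carrier = {M. det M = 1}, mult = (**), one = mat 1\<rparr>"

lemma group_SL2C: "group SL2C"
proof (rule groupI)
  fix M assume M: "M \<in> carrier SL2C"
  then have "invertible M" by (simp add: SL2C_def invertible_det_nz)
  then obtain N where N: "N ** M = mat 1" by (auto simp: invertible_def)
  then have "det N * det M = 1" by (metis det_I det_mul)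
  then show "\<exists>N\<in>carrier SL2C. N \<otimes>\<^bsub>SL2C\<^esub> M = \<one>\<^bsub>SL2C\<^esub>"
    using M N by (auto simp: SL2C_def)
qed (auto simp: SL2C_def det_mul det_I matrix_mul_assoc)

definition A_mat :: "complex \<Rightarrow> complex^2^2" where
  "A_mat l = vector [vector [1, l], vector [0, 1]]"

definition B_mat :: "complex \<Rightarrow> complex^2^2" where
  "B_mat m = vector [vector [1, 0], vector [m, 1]]"

datatype letter = LA | LB

fun gens :: "complex \<Rightarrow> complex \<Rightarrow> letter \<Rightarrow> complex^2^2" where
  "gens l m LA = A_mat l"
| "gens l m LB = B_mat m"

definition G_grp :: "complex \<Rightarrow> complex \<Rightarrow> (complex^2^2) monoid" where
  "G_grp l m = SL2C\<lparr>carrier := generate SL2C {A_mat l, B_mat m}\<rparr>"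

lemma A_mat_in_SL2C: "A_mat l \<in> carrier SL2C"
  and B_mat_in_SL2C: "B_mat m \<in> carrier SL2C"
  by (simp_all add: SL2C_def A_mat_def B_mat_def det_2)

lemma group_G_grp: "group (G_grp l m)"
  unfolding G_grp_def
  by (intro subgroup.subgroup_is_group group.generate_is_subgroup group_SL2C)
     (auto simp: A_mat_in_SL2C B_mat_in_SL2C)

end

theory Submission
  imports Defs
begin

text \<open>
  Write \<open>l = 2 (cos \<phi>)\<^sup>2\<close> with \<open>0 < \<phi> < pi / 2\<close>, so that \<open>\<phi> = arccos (sqrt (l / 2))\<close>. After a diagonal
  change of basis both generators become unipotent matrices with the same off-diagonal entry
  \<open>x = 2 cos \<phi>\<close>. If a vector is described by its slope, taken as first over second coordinate before
  a letter \<open>A\<close> and inverted before a letter \<open>B\<close>, then repeating a letter acts as \<open>\<tau> \<mapsto> \<tau> \<plusminus> x\<close> and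
  changing the generator acts as \<open>\<tau> \<mapsto> 1 / \<tau> \<plusminus> x\<close>, where the sign is that of the exponent.

  Apply a reduced word, one letter after the other from the right, to a coordinate vector. The
  claim is that the slope keeps the sign of the letter applied last. If the letter repeats, or if
  the generator changes and the sign does not, both summands have the same sign and the new slope
  has absolute value at least \<open>x\<close>. The only dangerous case is that generator and sign both change:
  then the slope, taken relative to the sign of the last letter, goes from \<open>\<tau>\<close> to \<open>x - 1 / \<tau>\<close>.
  Because \<open>x < 2\<close>, this Moebius map is elliptic, and the substitution
  \<open>\<tau> = sin (\<alpha> + \<phi>) / sin \<alpha>\<close> turns it into the rotation \<open>\<alpha> \<mapsto> \<alpha> + \<phi>\<close>. The value
  \<open>x\<close> corresponds to \<open>\<alpha> = \<phi>\<close>, hence after an alternating run of \<open>r\<close> letters, in which generator and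
  sign change at every step, this relative slope is still bounded below by \<open>sin ((r + 1) \<phi>) / sin (r \<phi>)\<close>, which is positive as long as \<open>(r + 1) \<phi> < pi\<close>
  (\<open>slope_lower_bound\<close>). A relator fixes the coordinate vector, whose slope is \<open>0\<close> or infinite;
  so it must contain an alternating run with \<open>(r + 1) \<phi> \<ge> pi\<close> (\<open>relator_has_long_alternating_subword\<close>).

  An alternating run of \<open>2 k + 1\<close> or \<open>2 k + 2\<close> letters contains the \<open>k\<close>-th power of \<open>A B\<^sup>-\<^sup>1\<close> or of
  \<open>A\<^sup>-\<^sup>1 B\<close>, and \<open>(2 k + 3) \<phi> \<ge> pi\<close> is more than what the asserted lower bound on \<open>k\<close> demands. The
  bound on \<open>\<sigma>\<close> follows since such a power has \<open>2 k\<close> syllables and passing to a subword does not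
  increase the number of syllables.
\<close>

section \<open>Alternating words\<close>

definition alternating :: "letter word \<Rightarrow> bool" where
  "alternating u \<longleftrightarrow> successively (\<lambda>x y. fst y \<noteq> fst x \<and> snd y \<noteq> snd x) u"

lemma alternating_prefix_power:
  assumes "alternating ((LA, s) # u)" "2 * k \<le> length ((LA, s) # u)"
  shows "prefix (word_power [(LA, s), (LB, \<not> s)] k) ((LA, s) # u)"
  using assms
proof (induction k arbitrary: u)
  case 0
  then show ?case by (simp add: word_power_def)
next
  case (Suc k)
  then obtain y v where u: "u = y # v" by (cases u) auto
  then have y: "y = (LB, \<not> s)"
    using Suc.prems(1) by (cases y; cases "fst y") (auto simp: alternating_def)
  have "prefix (word_power [(LA, s), (LB, \<not> s)] k) v"
  proof (cases v)
    case Nil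
    then have "k = 0" using Suc.prems(2) u by simp
    then show ?thesis by (simp add: word_power_def)
  next
    case (Cons z v')
    then have "z = (LA, s)"
      using Suc.prems(1) u y by (cases z; cases "fst z") (auto simp: alternating_def)
    moreover have "alternating v"
      using Suc.prems(1) u Cons by (simp add: alternating_def)
    ultimately show ?thesis
      using Suc.IH[of v'] Suc.prems(2) u Cons by simp
  qed
  then show ?case by (simp add: u y word_power_def)
qed

text \<open>A run of odd length \<open>2 k + 1\<close> is needed because the run may begin with the letter \<open>B\<close>, which has
  to be dropped before the powers of \<open>A B\<^sup>-\<^sup>1\<close> or \<open>A\<^sup>-\<^sup>1 B\<close> can start.\<close>

lemma alternating_contains_power:
  assumes "alternating u" "2 * k + 1 \<le> length u"
  shows "sublist (word_power [(LA, True), (LB, False)] k) u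
       \<or> sublist (word_power [(LA, False), (LB, True)] k) u"
proof -
  have *: "sublist (word_power [(LA, True), (LB, False)] k) ((LA, s) # v)
         \<or> sublist (word_power [(LA, False), (LB, True)] k) ((LA, s) # v)"
    if "alternating ((LA, s) # v)" "2 * k \<le> length ((LA, s) # v)" for s v
    using alternating_prefix_power[OF that] by (cases s) auto
  obtain g s v where u: "u = (g, s) # v" using assms(2) by (cases u) auto
  show ?thesis
  proof (cases g)
    case LA
    then show ?thesis using * assms u by simp
  next
    case LB
    show ?thesis
    proof (cases v)
      case Nil
      then have "k = 0" using assms(2) u by simp
      then show ?thesis by (simp add: word_power_def)
    next
      case (Cons y v')
      then obtain t where y: "y = (LA, t)"
        using assms(1) u LB by (cases y; cases "fst y") (auto simp: alternating_def)
      have "alternating v" using assms(1) u Cons by (simp add: alternating_def)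
      then have "sublist (word_power [(LA, True), (LB, False)] k) v
               \<or> sublist (word_power [(LA, False), (LB, True)] k) v"
        using * assms(2) u Cons y by simp
      then show ?thesis unfolding u by (metis sublist_Cons_right)
    qed
  qed
qed

section \<open>Ping-pong with a rotation\<close>

definition sign_of :: "bool \<Rightarrow> real" where
  "sign_of s = (if s then 1 else - 1)"

text \<open>The action of a letter in the basis in which both generators have off-diagonal entry \<open>x\<close>.\<close>

fun step :: "real \<Rightarrow> letter \<times> bool \<Rightarrow> real \<times> real \<Rightarrow> real \<times> real" where
  "step x (LA, s) (a, b) = (a + sign_of s * x * b, b)"
| "step x (LB, s) (a, b) = (a, b + sign_of s * x * a)"

text \<open>The coordinate on the projective line in which the given generator is a translation. Since a
  quotient by \<open>0\<close> is \<open>0\<close>, a nonzero slope certifies that both coordinates are nonzero.\<close>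

fun slope :: "letter \<Rightarrow> real \<times> real \<Rightarrow> real" where
  "slope LA (a, b) = a / b"
| "slope LB (a, b) = b / a"

text \<open>The vector on which the two slopes vanish and which the given generator moves: starting from
  it, the first letter already produces the slope \<open>\<plusminus> x\<close>.\<close>

fun base_vector :: "letter \<Rightarrow> real \<times> real" where
  "base_vector LA = (0, 1)"
| "base_vector LB = (1, 0)"

lemma slope_step_base: "slope g (step x (g, s) (base_vector g)) = sign_of s * x"
  by (cases g) auto

lemma slope_step:
  assumes "slope g p \<noteq> 0"
  shows "slope g (step x (g, s) p) = slope g p + sign_of s * x"
  using assms by (cases g; cases p) (auto simp: field_simps)

lemma slope_other:
  assumes "g \<noteq> h"
  shows "slope g p = 1 / slope h p"
  using assms by (cases g; cases h; cases p) auto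

text \<open>The map \<open>\<tau> \<mapsto> 2 cos \<phi> - 1 / \<tau>\<close> is conjugate to the rotation \<open>\<alpha> \<mapsto> \<alpha> + \<phi>\<close> through
  \<open>\<tau> = sin (\<alpha> + \<phi>) / sin \<alpha>\<close>; this is the addition theorem for
  \<open>sin ((\<alpha> + \<phi>) + \<phi>) + sin ((\<alpha> + \<phi>) - \<phi>)\<close>.\<close>

lemma sin_ratio_recurrence:
  fixes \<phi> \<alpha> :: real
  assumes "sin (\<alpha> + \<phi>) \<noteq> 0"
  shows "2 * cos \<phi> - sin \<alpha> / sin (\<alpha> + \<phi>) = sin (\<alpha> + 2 * \<phi>) / sin (\<alpha> + \<phi>)"
proof -
  have "sin ((\<alpha> + \<phi>) + \<phi>) + sin ((\<alpha> + \<phi>) - \<phi>) = 2 * cos \<phi> * sin (\<alpha> + \<phi>)"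
    unfolding sin_add sin_diff by simp
  then have "sin (\<alpha> + 2 * \<phi>) = 2 * cos \<phi> * sin (\<alpha> + \<phi>) - sin \<alpha>"
    by (simp add: algebra_simps)
  then show ?thesis using assms by (simp add: field_simps)
qed

text \<open>The ping-pong argument. The witness \<open>u\<close> records how far the rotation has proceeded: it is
  extended by a letter that changes both the generator and the sign, and restarted at a single letter
  otherwise, when the two summands of the new slope have the same sign. A letter with the same
  generator and the opposite sign cannot occur in a reduced word.\<close>

lemma slope_lower_bound:
  fixes \<phi> :: real
  assumes \<phi>: "0 < \<phi>" "\<phi> < pi / 2"
    and "reduced w" "w \<noteq> []"
    and short: "\<And>u. sublist u w \<Longrightarrow> alternating u \<Longrightarrow> real (length u + 1) * \<phi> < pi"
  shows "\<exists>u. u \<noteq> [] \<and> alternating u \<and> prefix u w \<and>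
           sin (real (length u + 1) * \<phi>) / sin (real (length u) * \<phi>)
             \<le> sign_of (snd (hd w)) *
                slope (fst (hd w)) (foldr (step (2 * cos \<phi>)) w (base_vector (fst (last w))))"
  using assms(3-)
proof (induction w)
  case Nil
  then show ?case by simp
next
  case (Cons y w)
  obtain g s where y: "y = (g, s)" by force
  have s2: "sign_of s * sign_of s = 1" by (simp add: sign_of_def)
  have sin\<phi>: "sin \<phi> > 0" using \<phi> by (intro sin_gt_zero) auto
  have one: "sin (real (length [y] + 1) * \<phi>) / sin (real (length [y]) * \<phi>) = 2 * cos \<phi>"
    using sin\<phi> by (simp add: sin_double)
  have alt_one: "alternating [y]" by (simp add: alternating_def)
  show ?case
  proof (cases "w = []")
    case True
    have "sign_of s * slope g (step (2 * cos \<phi>) (g, s) (base_vector g)) = 2 * cos \<phi>"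
      unfolding slope_step_base using s2 by (metis mult.assoc mult_1)
    then show ?thesis
      using True one alt_one y by (intro exI[of _ "[y]"]) auto
  next
    case False
    obtain h t where h: "hd w = (h, t)" by force
    define p where "p = foldr (step (2 * cos \<phi>)) w (base_vector (fst (last w)))"
    have red: "reduced w" and noinv: "(h, t) \<noteq> flip (g, s)"
      using Cons.prems(1) False h y by (cases w; auto simp: reduced_def)+
    have "real (length u + 1) * \<phi> < pi" if "sublist u w" "alternating u" for u
      using Cons.prems(3)[OF _ that(2)] that(1) by (metis sublist_Cons_right)
    from Cons.IH[OF red False this] obtain u where u: "u \<noteq> []" "alternating u" "prefix u w"
      and bound: "sin (real (length u + 1) * \<phi>) / sin (real (length u) * \<phi>)
        \<le> sign_of t * slope h p"
      using h unfolding p_def by auto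
    define \<alpha> where "\<alpha> = real (length u) * \<phi>"
    have len1: "real (length u + 1) * \<phi> = \<alpha> + \<phi>" by (simp add: \<alpha>_def algebra_simps)
    have "sublist u (y # w)" using u(3) by (metis prefix_imp_sublist sublist_Cons_right)
    from Cons.prems(3)[OF this u(2)] have "\<alpha> + \<phi> < pi" by (simp only: len1)
    moreover have "\<alpha> > 0" using u(1) \<phi> by (simp add: \<alpha>_def)
    ultimately have sin\<alpha>: "sin \<alpha> > 0" "sin (\<alpha> + \<phi>) > 0"
      using \<phi> by (auto intro!: sin_gt_zero)
    have bound': "sin (\<alpha> + \<phi>) / sin \<alpha> \<le> sign_of t * slope h p"
      using bound unfolding len1 by (simp only: \<alpha>_def)
    then have pos: "sign_of t * slope h p > 0" using sin\<alpha> by (smt (verit) divide_pos_pos)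
    then have nz: "slope g p \<noteq> 0" using slope_other[of g h p] by (cases "g = h") auto
    have img: "foldr (step (2 * cos \<phi>)) (y # w) (base_vector (fst (last (y # w))))
        = step (2 * cos \<phi>) (g, s) p"
      using False by (simp add: p_def y)
    have next_slope: "sign_of s * slope g (step (2 * cos \<phi>) (g, s) p)
        = sign_of s * slope g p + 2 * cos \<phi>"
      unfolding slope_step[OF nz] using s2 by (simp add: algebra_simps)
    \<comment> \<open>Equal signs restart the rotation at the one-letter run; opposite signs advance it.\<close>
    show ?thesis
    proof (cases "s = t")
      case True
      have "sign_of s * slope g p > 0"
      proof (cases "g = h")
        case False
        have "sign_of s * slope g p = 1 / (sign_of t * slope h p)"
          using slope_other[OF False, of p] True by (auto simp: sign_of_def)
        then show ?thesis using pos by simp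
      qed (use pos True in simp)
      then have "2 * cos \<phi> \<le> sign_of s * slope g (step (2 * cos \<phi>) (g, s) p)"
        unfolding next_slope by simp
      then show ?thesis
        unfolding img list.sel(1) using one alt_one by (intro exI[of _ "[y]"]) (simp add: y)
    next
      case False
      then have gh: "g \<noteq> h" using noinv by (auto simp: flip_def)
      have "sign_of s * slope g p = - (1 / (sign_of t * slope h p))"
        using slope_other[OF gh, of p] False by (auto simp: sign_of_def)
      moreover have "1 / (sign_of t * slope h p) \<le> sin \<alpha> / sin (\<alpha> + \<phi>)"
        using bound' sin\<alpha> pos by (simp add: field_simps)
      ultimately have "2 * cos \<phi> - sin \<alpha> / sin (\<alpha> + \<phi>)
          \<le> sign_of s * slope g (step (2 * cos \<phi>) (g, s) p)"
        unfolding next_slope by simp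
      then have main: "sin (\<alpha> + 2 * \<phi>) / sin (\<alpha> + \<phi>)
          \<le> sign_of s * slope g (step (2 * cos \<phi>) (g, s) p)"
        using sin_ratio_recurrence[of \<alpha> \<phi>] sin\<alpha> by simp
      have "hd u = (h, t)" using u(1,3) h by (cases u; cases w) auto
      then have "alternating (y # u)"
        using u(1,2) gh False y by (cases u) (auto simp: alternating_def)
      moreover have "real (length (y # u)) * \<phi> = \<alpha> + \<phi>"
        "real (length (y # u) + 1) * \<phi> = \<alpha> + 2 * \<phi>"
        by (simp_all add: \<alpha>_def algebra_simps)
      ultimately show ?thesis
        unfolding img list.sel(1) using main u(3)
        by (intro exI[of _ "y # u"]) (simp add: y del: length_Cons of_nat_add of_nat_Suc)
    qed
  qed
qed

section \<open>Matrices and the normalised action\<close>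

lemma inv_gens:
  "inv\<^bsub>G_grp l m\<^esub> (gens l m g) = gens (- l) (- m) g"
proof -
  have sub: "subgroup (generate SL2C {A_mat l, B_mat m}) SL2C"
    by (intro group.generate_is_subgroup group_SL2C) (auto simp: A_mat_in_SL2C B_mat_in_SL2C)
  have "gens l m g \<in> generate SL2C {A_mat l, B_mat m}"
    by (cases g) (auto intro: generate.incl)
  then have "inv\<^bsub>G_grp l m\<^esub> (gens l m g) = inv\<^bsub>SL2C\<^esub> (gens l m g)"
    unfolding G_grp_def by (rule group.m_inv_consistent[OF group_SL2C sub])
  also have "\<dots> = gens (- l) (- m) g"
  proof (rule group.inv_equality[OF group_SL2C])
    show "gens (- l) (- m) g \<otimes>\<^bsub>SL2C\<^esub> gens l m g = \<one>\<^bsub>SL2C\<^esub>"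
      by (cases g) (simp_all add: SL2C_def A_mat_def B_mat_def matrix_matrix_mult_def
          mat_def vec_eq_iff sum_2 forall_2)
  qed (cases g; simp add: A_mat_in_SL2C B_mat_in_SL2C)+
  finally show ?thesis .
qed

text \<open>The change of basis \<open>diag \<kappa> 1\<close>, which brings the entries \<open>x \<kappa>\<close> and \<open>x / \<kappa>\<close> of the two
  generators to the common value \<open>x\<close>.\<close>

definition to_vector :: "real \<Rightarrow> real \<times> real \<Rightarrow> complex^2" where
  "to_vector \<kappa> p = vector [complex_of_real (\<kappa> * fst p), complex_of_real (snd p)]"

lemma to_vector_inject: "\<kappa> \<noteq> 0 \<Longrightarrow> to_vector \<kappa> p = to_vector \<kappa> q \<longleftrightarrow> p = q"
  by (auto simp: to_vector_def vec_eq_iff forall_2 prod_eq_iff)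

lemma word_value_to_vector:
  assumes "\<kappa> \<noteq> 0" "l = complex_of_real (x * \<kappa>)" "m = complex_of_real (x / \<kappa>)"
  shows "word_value (G_grp l m) (gens l m) w *v to_vector \<kappa> p = to_vector \<kappa> (foldr (step x) w p)"
proof (induction w)
  case Nil
  then show ?case by (simp add: word_value_def G_grp_def SL2C_def)
next
  case (Cons y w)
  obtain g s where y: "y = (g, s)" by force
  have mult: "(\<otimes>\<^bsub>G_grp l m\<^esub>) = (**)" by (simp add: G_grp_def SL2C_def)
  have letter: "(if s then gens l m g else inv\<^bsub>G_grp l m\<^esub> (gens l m g)) *v to_vector \<kappa> q
      = to_vector \<kappa> (step x (g, s) q)" for q
    using assms unfolding inv_gens
    by (cases g; cases q)
      (auto simp: to_vector_def A_mat_def B_mat_def matrix_vector_mult_def vec_eq_iff sum_2 forall_2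
        sign_of_def algebra_simps)
  show ?case
    using Cons.IH by (simp add: word_value_def y mult letter flip: matrix_vector_mul_assoc)
qed

text \<open>The starting vector is adapted to the rightmost letter of the relator. As the relator fixes it,
  the slope with respect to the leftmost letter is \<open>0\<close>, whichever generator that is, whereas short
  alternating runs would make it nonzero.\<close>

lemma relator_has_long_alternating_subword:
  fixes \<phi> \<kappa> :: real
  assumes \<phi>: "0 < \<phi>" "\<phi> < pi / 2" and \<kappa>: "\<kappa> \<noteq> 0"
    and l: "l = complex_of_real (2 * cos \<phi> * \<kappa>)" and m: "m = complex_of_real (2 * cos \<phi> / \<kappa>)"
    and w: "relator (G_grp l m) (gens l m) w"
  shows "\<exists>u. sublist u w \<and> alternating u \<and> pi \<le> real (length u + 1) * \<phi>"
proof (rule ccontr)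
  assume no_long: "\<not> ?thesis"
  then have short: "real (length u + 1) * \<phi> < pi" if "sublist u w" "alternating u" for u
    using no_long that by (meson not_le)
  have w': "w \<noteq> []" "reduced w" "word_value (G_grp l m) (gens l m) w = mat 1"
    using w by (auto simp: relator_def G_grp_def SL2C_def)
  define e where "e = base_vector (fst (last w))"
  have fixed: "foldr (step (2 * cos \<phi>)) w e = e"
    using word_value_to_vector[OF \<kappa> l m, of w e] w'(3) to_vector_inject[OF \<kappa>] by simp
  obtain u where u: "u \<noteq> []" "alternating u" "prefix u w"
    and le: "sin (real (length u + 1) * \<phi>) / sin (real (length u) * \<phi>)
      \<le> sign_of (snd (hd w)) * slope (fst (hd w)) e"
    using slope_lower_bound[OF \<phi> w'(2,1) short] fixed unfolding e_def by auto
  have "slope (fst (hd w)) e = 0"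
    unfolding e_def by (cases "fst (hd w)"; cases "fst (last w)") auto
  moreover have "sin (real (length u + 1) * \<phi>) / sin (real (length u) * \<phi>) > 0"
  proof -
    have "real (length u + 1) * \<phi> < pi" using short u by auto
    moreover have "real (length u) * \<phi> > 0" using u \<phi> by simp
    ultimately show ?thesis
      using \<phi> by (intro divide_pos_pos sin_gt_zero) (auto simp: algebra_simps)
  qed
  ultimately show False using le by simp
qed

section \<open>Counting syllables\<close>

text \<open>Merging adjacent equal generators leaves one entry per syllable, since adjacent letters of a
  reduced word with the same generator have the same sign. In this form the number of syllables is
  visibly monotone in the word.\<close>

lemma syl_eq_length_remdups_adj:
  assumes "reduced w"
  shows "syl w = length (remdups_adj (map fst w))"
  using reduced_syllable_form[OF assms] syl_eq remdups_adj_expand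
  unfolding syllable_form_def by (metis length_map)

lemma length_remdups_adj_mono_sublist:
  assumes "sublist xs ys"
  shows "length (remdups_adj xs) \<le> length (remdups_adj ys)"
proof -
  have app: "length (remdups_adj zs) \<le> length (remdups_adj (as @ zs))" for as zs :: "'a list"
  proof (induction as)
    case (Cons a as)
    then show ?case by (auto simp: remdups_adj_Cons split: list.splits)
  qed simp
  obtain as bs where ys: "ys = as @ xs @ bs" using assms by (auto simp: sublist_def)
  have "length (remdups_adj xs) = length (remdups_adj (rev xs))"
    by (simp add: remdups_adj_rev)
  also have "\<dots> \<le> length (remdups_adj (rev bs @ rev xs))" by (rule app)
  also have "\<dots> = length (remdups_adj (xs @ bs))"
    by (metis length_rev remdups_adj_rev rev_append)
  also have "\<dots> \<le> length (remdups_adj ys)" unfolding ys by (rule app)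
  finally show ?thesis .
qed

lemma syl_ge_of_power:
  assumes "reduced w" "sublist (word_power [(g, s), (h, t)] k) w" "g \<noteq> h"
  shows "2 * k \<le> syl w"
proof -
  have eq: "remdups_adj (map fst (word_power [(g, s), (h, t)] j))
      = map fst (word_power [(g, s), (h, t)] j)" for j
  proof (induction j)
    case (Suc j)
    then show ?case using assms(3) by (cases j) (auto simp: word_power_def)
  qed (simp add: word_power_def)
  have "2 * k = length (word_power [(g, s), (h, t)] k)"
    by (induction k) (auto simp: word_power_def)
  also have "\<dots> = length (remdups_adj (map fst (word_power [(g, s), (h, t)] k)))"
    by (simp add: eq)
  also have "\<dots> \<le> syl w"
    unfolding syl_eq_length_remdups_adj[OF assms(1)]
    by (intro length_remdups_adj_mono_sublist map_mono_sublist assms(2))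
  finally show ?thesis .
qed

text \<open>A strict lower bound survives the infimum because syllable numbers are integers: all of them are
  at least the smallest natural number exceeding \<open>c\<close>.\<close>

lemma sigma_syl_greater:
  assumes "\<And>w. relator G g w \<Longrightarrow> real (syl w) > c"
  shows "ereal_of_enat (sigma_syl G g) > ereal c"
proof -
  define N where "N = (LEAST n::nat. c < real n)"
  have N: "c < real N" unfolding N_def using reals_Archimedean2 by (rule LeastI_ex)
  have "enat N \<le> sigma_syl G g"
    unfolding sigma_syl_def
    by (intro INF_greatest) (auto simp: N_def intro!: Least_le assms)
  then have "ereal (real N) \<le> ereal_of_enat (sigma_syl G g)"
    using ereal_of_enat_le_iff[of "enat N" "sigma_syl G g"] by simp
  moreover have "ereal c < ereal (real N)" using N by simp
  ultimately show ?thesis by (rule less_le_trans[rotated])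
qed

theorem theorem1p4:
  fixes l :: real
  assumes "1.8 \<le> l" and "l < 2"
  shows "(\<forall>w. relator (G_grp (complex_of_real l) 2) (gens (complex_of_real l) 2) w \<longrightarrow>
            (\<exists>k::nat. real k > 1 / (4 * arccos (sqrt (l / 2))) - 1 \<and>
               (sublist (word_power [(LA, True), (LB, False)] k) w \<or>
                sublist (word_power [(LA, False), (LB, True)] k) w)))
       \<and> ereal_of_enat (sigma_syl (G_grp (complex_of_real l) 2) (gens (complex_of_real l) 2))
            > ereal (2 * (1 / (4 * arccos (sqrt (l / 2))) - 1))"
proof -
  define \<phi> where "\<phi> = arccos (sqrt (l / 2))"
  define G where "G = G_grp (complex_of_real l) 2"
  define gs where "gs = gens (complex_of_real l) 2"
  have sqrt: "0 < sqrt (l / 2)" "sqrt (l / 2) < 1" using assms by auto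
  have cos: "cos \<phi> = sqrt (l / 2)" unfolding \<phi>_def using sqrt by (intro cos_arccos) linarith+
  have \<phi>: "0 < \<phi>" "\<phi> < pi / 2"
    using arccos_lt_bounded[of "sqrt (l / 2)"] arccos_less_arccos[of 0 "sqrt (l / 2)"] sqrt
    by (simp_all only: \<phi>_def arccos_0)
  have power: "\<exists>k::nat. real k > 1 / (4 * \<phi>) - 1 \<and>
      (sublist (word_power [(LA, True), (LB, False)] k) w \<or>
       sublist (word_power [(LA, False), (LB, True)] k) w)" if "relator G gs w" for w
  proof -
    \<comment> \<open>The entries are \<open>l = 2 cos \<phi> * \<kappa>\<close> and \<open>2 = 2 cos \<phi> / \<kappa>\<close> for \<open>\<kappa> = cos \<phi>\<close>.\<close>
    have nz: "cos \<phi> \<noteq> 0" using cos sqrt by simp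
    have l_eq: "complex_of_real l = complex_of_real (2 * cos \<phi> * cos \<phi>)"
    proof -
      have "cos \<phi> * cos \<phi> = l / 2" unfolding cos using assms by simp
      then show ?thesis by (simp only: mult.assoc) simp
    qed
    have two_eq: "2 = complex_of_real (2 * cos \<phi> / cos \<phi>)"
      using nz by simp
    obtain u where u: "sublist u w" "alternating u" "real (length u + 1) * \<phi> \<ge> pi"
      using relator_has_long_alternating_subword[OF \<phi> nz l_eq two_eq] \<open>relator G gs w\<close>
      unfolding G_def gs_def by blast
    have "u \<noteq> []" using u(3) \<phi> by auto
    then have "length u \<ge> 1" by (simp add: Suc_le_eq)
    define k where "k = (length u - 1) div 2"
    have k: "2 * k + 1 \<le> length u" "length u \<le> 2 * k + 2"
      using \<open>length u \<ge> 1\<close> by (auto simp: k_def)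
    have "real (length u + 1) \<le> 2 * real k + 3" using k(2) by linarith
    then have "real (length u + 1) * \<phi> \<le> (2 * real k + 3) * \<phi>"
      using \<phi>(1) by (intro mult_right_mono) auto
    with u(3) have "pi \<le> (2 * real k + 3) * \<phi>" by linarith
    \<comment> \<open>Doubling gives \<open>4 (k + 1) \<phi> \<ge> 2 pi - 2 \<phi> > pi > 1\<close>.\<close>
    then have "1 < 4 * (real k + 1) * \<phi>"
      using \<phi> pi_gt3 by (simp add: algebra_simps)
    then have "1 / (4 * \<phi>) < real k + 1" using \<phi> by (simp add: field_simps)
    then have "1 / (4 * \<phi>) - 1 < real k" by linarith
    moreover have "sublist (word_power [(LA, True), (LB, False)] k) w \<or>
       sublist (word_power [(LA, False), (LB, True)] k) w"
      using alternating_contains_power[OF u(2) k(1)] u(1) sublist_order.order_trans by blast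
    ultimately show ?thesis by blast
  qed
  have "real (syl w) > 2 * (1 / (4 * \<phi>) - 1)" if "relator G gs w" for w
  proof -
    have "reduced w" using that by (simp add: relator_def)
    obtain k where k: "real k > 1 / (4 * \<phi>) - 1"
      "sublist (word_power [(LA, True), (LB, False)] k) w \<or>
       sublist (word_power [(LA, False), (LB, True)] k) w"
      using power[OF \<open>relator G gs w\<close>] by blast
    from k(2) have "2 * k \<le> syl w" using syl_ge_of_power[OF \<open>reduced w\<close>] by blast
    then have "2 * real k \<le> real (syl w)" by linarith
    with mult_strict_left_mono[OF k(1) zero_less_numeral] show ?thesis
      by (rule order.strict_trans2)
  qed
  then have "ereal_of_enat (sigma_syl G gs) > ereal (2 * (1 / (4 * \<phi>) - 1))"
    by (rule sigma_syl_greater)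
  then show ?thesis using power unfolding \<phi>_def G_def gs_def by blast
qed

end
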